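(* A finite graded poset $P$ is an Eeta win if and only if its skeleton $\mathcal{T}_P$ is an Eeta win.
   Context: Ungar game: for a finite poset $P$, the positions are order ideals (down-closed subsets) $X$ of $P$, the starting position being $X=P$. A nontrivial Ungar move replaces $X$ by $X\setminus T$, where $T$ is a nonempty subset of the set $\max(X)$ of maximal elements of $X$. Two players, Atniss (who moves first) and Eeta (who moves second), alternate making nontrivial Ungar moves; the first player who cannot make one (i.e. the player to move when $X=\varnothing$) loses. A finite poset $P$ is an Atniss win if the first player has a winning strategy starting from $P$, and an Eeta win otherwise. Any subset of a poset is regarded as a poset with the induced order (and so is itself an Atniss win or an Eeta win). A poset $P$ is graded if there is a rank function $\rho:P\to\mathbb{N}$ with $\rho(x)=\rho(y)+1$ whenever $x$ covers $y$ (maximal elements need not have equal rank, nor minimal elements). The skeleton $\mathcal{T}_P$ of a poset $P$ is the subposet of all elements $x\in P$ that are not less than two incomparable elements of $P$, i.e. such that there are no incomparable $a,b\in P$ with $x<a$ and $x<b$. *)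

theory Defs
  imports Main
begin

text \<open>
  Posets are sets \<open>P :: 'a set\<close> over a type of class \<open>order\<close>, with the induced order; subsets of
  \<open>P\<close> are then subposets. Every poset is of this form up to isomorphism: embed it into its power
  set, ordered by inclusion, by sending an element to its principal ideal.
\<close>

subsection \<open>Graded posets and skeletons\<close>

definition covers_in :: "'a::order set \<Rightarrow> 'a \<Rightarrow> 'a \<Rightarrow> bool" where
  "covers_in P x y \<longleftrightarrow> x \<in> P \<and> y \<in> P \<and> y < x \<and> \<not> (\<exists>z\<in>P. y < z \<and> z < x)"

definition graded_poset :: "'a::order set \<Rightarrow> bool" where
  "graded_poset P \<longleftrightarrow> (\<exists>\<rho> :: 'a \<Rightarrow> nat. \<forall>x y. covers_in P x y \<longrightarrow> \<rho> x = \<rho> y + 1)"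

definition incomparable :: "'a::order \<Rightarrow> 'a \<Rightarrow> bool" where
  "incomparable a b \<longleftrightarrow> \<not> a \<le> b \<and> \<not> b \<le> a"

definition skeleton :: "'a::order set \<Rightarrow> 'a set" where
  "skeleton P = {x \<in> P. \<not> (\<exists>a\<in>P. \<exists>b\<in>P. incomparable a b \<and> x < a \<and> x < b)}"


subsection \<open>The Ungar game\<close>

definition maximal_elements :: "'a::order set \<Rightarrow> 'a set" where
  "maximal_elements X = {x \<in> X. \<not> (\<exists>y\<in>X. x < y)}"

definition order_ideal :: "'a::order set \<Rightarrow> 'a set \<Rightarrow> bool" where
  "order_ideal P X \<longleftrightarrow> X \<subseteq> P \<and> (\<forall>x\<in>X. \<forall>y\<in>P. y \<le> x \<longrightarrow> y \<in> X)"

definition ungar_move :: "'a::order set \<Rightarrow> 'a set \<Rightarrow> bool" where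
  "ungar_move X Y \<longleftrightarrow> (\<exists>T. T \<noteq> {} \<and> T \<subseteq> maximal_elements X \<and> Y = X - T)"

text \<open>
  A (possibly unfinished) play is the nonempty list of the positions visited so far, beginning with
  \<open>P\<close>. Atniss is to move exactly when the length of this list is odd.
\<close>

definition ungar_play :: "'a::order set \<Rightarrow> 'a set list \<Rightarrow> bool" where
  "ungar_play P ps \<longleftrightarrow> ps \<noteq> [] \<and> hd ps = P \<and> successively ungar_move ps"

lemma order_ideal_ungar_move:
  assumes "order_ideal P X" "ungar_move X Y"
  shows "order_ideal P Y"
proof -
  obtain T where T: "T \<subseteq> maximal_elements X" and Y: "Y = X - T"
    using assms(2) unfolding ungar_move_def by blast
  have "y \<in> Y" if "x \<in> Y" "y \<in> P" "y \<le> x" for x y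
  proof -
    have "y \<in> X"
      using assms(1) that Y unfolding order_ideal_def by blast
    moreover have "y \<notin> T"
    proof
      assume "y \<in> T"
      then have "\<not> y < x"
        using T that(1) Y unfolding maximal_elements_def by blast
      with that(3) have "y = x"
        by simp
      with \<open>y \<in> T\<close> that(1) Y show False
        by blast
    qed
    ultimately show ?thesis
      using Y by blast
  qed
  then show ?thesis
    using assms(1) Y unfolding order_ideal_def by blast
qed

lemma order_ideal_ungar_play:
  assumes "ungar_play P ps" "X \<in> set ps"
  shows "order_ideal P X"
proof -
  have "order_ideal P (ps ! n)" if "n < length ps" for n
    using that
  proof (induction n)
    case 0
    then show ?case
      using assms(1) by (simp add: ungar_play_def hd_conv_nth order_ideal_def)
  next
    case (Suc n)
    have "ungar_move (ps ! n) (ps ! Suc n)"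
      using assms(1) Suc.prems by (simp add: ungar_play_def successively_conv_nth)
    with Suc show ?case
      using order_ideal_ungar_move by (metis Suc_lessD)
  qed
  with assms(2) show ?thesis
    by (metis in_set_conv_nth)
qed

definition complete_ungar_play :: "'a::order set \<Rightarrow> 'a set list \<Rightarrow> bool" where
  "complete_ungar_play P ps \<longleftrightarrow> ungar_play P ps \<and> \<not> (\<exists>Y. ungar_move (last ps) Y)"

text \<open>
  A strategy of Atniss assigns to each play in which it is her turn, and in which she is able to
  move, the next position; its values on all other lists are irrelevant.
\<close>

definition atniss_strategy :: "'a::order set \<Rightarrow> ('a set list \<Rightarrow> 'a set) \<Rightarrow> bool" where
  "atniss_strategy P \<sigma> \<longleftrightarrow>
    (\<forall>ps. ungar_play P ps \<and> odd (length ps) \<and> (\<exists>Y. ungar_move (last ps) Y)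
      \<longrightarrow> ungar_move (last ps) (\<sigma> ps))"

definition follows_strategy :: "('a set list \<Rightarrow> 'a set) \<Rightarrow> 'a set list \<Rightarrow> bool" where
  "follows_strategy \<sigma> ps \<longleftrightarrow> (\<forall>n < length ps. odd n \<longrightarrow> ps ! n = \<sigma> (take n ps))"

text \<open>
  The player to move at the end of a complete play loses, so Atniss wins the complete play \<open>ps\<close>
  iff \<open>length ps\<close> is even. For infinite \<open>P\<close>, where plays need not terminate, the following
  predicates are not meaningful.
\<close>

definition atniss_win :: "'a::order set \<Rightarrow> bool" where
  "atniss_win P \<longleftrightarrow>
    (\<exists>\<sigma>. atniss_strategy P \<sigma> \<and>
      (\<forall>ps. complete_ungar_play P ps \<and> follows_strategy \<sigma> ps \<longrightarrow> even (length ps)))"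

definition eeta_win :: "'a::order set \<Rightarrow> bool" where
  "eeta_win P \<longleftrightarrow> \<not> atniss_win P"

end

theory Submission
  imports Defs
begin

text \<open>
  In a rooted forest, with the roots on top, the Ungar game is a selective compound: a move is made
  in any nonempty set of trees, and in a tree with root \<open>c\<close> the only move deletes \<open>c\<close> and leaves
  the branches below it. A selective compound is lost for the player to move exactly when every
  component is, so a tree is a first-player win iff all branches below its root are losses
  (\<open>tree_win\<close>), and a forest is an Eeta win iff no tree in it is a win (\<open>no_tree_win\<close>).

  The skeleton of \<open>P\<close> is a forest: it is an upper set of \<open>P\<close> in which the elements above a given one
  form a chain. Its trees can be read off from \<open>P\<close> itself, since the branches below a skeleton
  element \<open>c\<close> start at those \<open>z < c\<close> all of whose strict upper bounds are at least \<open>c\<close>. Thus \<open>P\<close> and its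
  skeleton agree on \<open>no_tree_win\<close>, and the task is to show that \<open>no_tree_win\<close> characterises the
  lost positions for every graded poset, although deleting maximal elements may enlarge the skeleton.
  Here gradedness enters: deleting \<open>T\<close> can attach new branches only below elements that have
  the rank of some member of \<open>T\<close>. Hence trees whose root has smaller rank than all of \<open>T\<close> keep their
  value (\<open>tree_win_Diff\<close>).

  If no tree of \<open>X\<close> is a win and \<open>T\<close> is deleted, then some branch below an element of \<open>T\<close> of least
  rank is a win, it keeps its value, and it becomes a tree of \<open>X - T\<close>
  (\<open>no_tree_win_imp_not_no_tree_win_Diff\<close>). In the other direction, a set \<open>T\<close> for which
  \<open>X - T\<close> has no winning tree is built rank by rank, in increasing order
  (\<open>clear_rank\<close>): among the maximal elements of rank \<open>k\<close>, delete an inclusion-maximal set that exposes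
  no winning tree of rank below \<open>k\<close>. By maximality, deleting one more element of rank \<open>k\<close> would expose
  such a tree, which is therefore a branch below that element and makes its tree a loss.
\<close>

section \<open>Solving the game by backward induction\<close>

lemma ungar_moveE:
  assumes "ungar_move X Y"
  obtains T where "T \<noteq> {}" "T \<subseteq> maximal_elements X" "Y = X - T"
  using assms unfolding ungar_move_def by blast

lemma ungar_move_psubset: "ungar_move X Y \<Longrightarrow> Y \<subset> X"
  unfolding ungar_move_def maximal_elements_def by blast

lemma ungar_play_snoc:
  "ungar_play P ps \<Longrightarrow> ungar_move (last ps) Y \<Longrightarrow> ungar_play P (ps @ [Y])"
  by (auto simp: ungar_play_def successively_append_iff)

lemma follows_strategy_snoc:
  assumes "follows_strategy \<sigma> ps" "odd (length ps) \<Longrightarrow> Y = \<sigma> ps"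
  shows "follows_strategy \<sigma> (ps @ [Y])"
  unfolding follows_strategy_def
proof (intro allI impI)
  fix n assume "n < length (ps @ [Y])" "odd n"
  then show "(ps @ [Y]) ! n = \<sigma> (take n (ps @ [Y]))"
    using assms by (cases "n = length ps") (auto simp: follows_strategy_def nth_append)
qed

text \<open>
  Strategies are functions of the whole play. The following context reduces statements about them
  to a kernel \<open>K\<close> of the move relation: no move joins two positions in \<open>K\<close>, and every position
  outside \<open>K\<close> has a move into \<open>K\<close>.
\<close>

context
  fixes P :: "'a::order set" and K :: "'a set \<Rightarrow> bool"
  assumes finite_P: "finite P"
    and kernel: "\<And>X. order_ideal P X \<Longrightarrow> K X \<longleftrightarrow> (\<forall>Y. ungar_move X Y \<longrightarrow> \<not> K Y)"
begin

text \<open>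
  Against any strategy of Atniss, Eeta can answer each move out of \<open>K\<close> by a move back into \<open>K\<close>;
  positions shrink, so this ends, and it ends with Atniss to move.
\<close>

lemma losing_play_from_kernel:
  assumes "atniss_strategy P \<sigma>" "ungar_play P ps" "follows_strategy \<sigma> ps"
    and "odd (length ps)" "K (last ps)"
  shows "\<exists>qs. complete_ungar_play P qs \<and> follows_strategy \<sigma> qs \<and> odd (length qs)"
  using assms
proof (induction "card (last ps)" arbitrary: ps rule: less_induct)
  case less
  have ps: "ps \<noteq> []"
    using less.prems unfolding ungar_play_def by blast
  have ideal: "order_ideal P (last ps)"
    using order_ideal_ungar_play[OF less.prems(2)] ps by simp
  show ?case
  proof (cases "\<exists>Y. ungar_move (last ps) Y")
    case False
    then show ?thesis
      using less.prems unfolding complete_ungar_play_def by blast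
  next
    case True
    let ?Y = "\<sigma> ps"
    have Y: "ungar_move (last ps) ?Y"
      using less.prems True unfolding atniss_strategy_def by blast
    then have "\<not> K ?Y"
      using kernel[OF ideal] less.prems by blast
    then obtain Z where Z: "ungar_move ?Y Z" "K Z"
      using kernel order_ideal_ungar_move[OF ideal Y] by blast
    let ?qs = "(ps @ [?Y]) @ [Z]"
    have "finite (last ps)"
      using ideal finite_P finite_subset unfolding order_ideal_def by blast
    moreover have "Z \<subset> last ps"
      using ungar_move_psubset[OF Y] ungar_move_psubset[OF Z(1)] by blast
    ultimately have "card (last ?qs) < card (last ps)"
      by (simp add: psubset_card_mono)
    moreover have "ungar_play P ?qs"
      using ungar_play_snoc[OF ungar_play_snoc[OF less.prems(2) Y], of Z] Z by simp
    moreover have "follows_strategy \<sigma> ?qs"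
      using less.prems by (intro follows_strategy_snoc) auto
    ultimately show ?thesis
      using less.hyps[of ?qs] less.prems Z by simp
  qed
qed

lemma atniss_win_outside_kernel:
  assumes "\<not> K P"
  shows "atniss_win P"
proof -
  define \<sigma> where "\<sigma> ps = (SOME Y. ungar_move (last ps) Y \<and> (K (last ps) \<or> K Y))" for ps
  have \<sigma>: "ungar_move (last ps) (\<sigma> ps) \<and> (K (last ps) \<or> K (\<sigma> ps))"
    if "ungar_play P ps" "\<exists>Y. ungar_move (last ps) Y" for ps
  proof -
    have "ps \<noteq> []"
      using that unfolding ungar_play_def by blast
    then have "order_ideal P (last ps)"
      using order_ideal_ungar_play[OF that(1)] by simp
    then have "\<exists>Y. ungar_move (last ps) Y \<and> (K (last ps) \<or> K Y)"
      using kernel that by blast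
    then show ?thesis
      unfolding \<sigma>_def by (rule someI_ex)
  qed
  have strategy: "atniss_strategy P \<sigma>"
    using \<sigma> unfolding atniss_strategy_def by blast
  have "even (length ps)" if ps: "complete_ungar_play P ps" "follows_strategy \<sigma> ps" for ps
  proof -
    have play: "ungar_play P ps" and stuck: "\<not> (\<exists>Y. ungar_move (last ps) Y)"
      using ps unfolding complete_ungar_play_def by auto
    have nonempty: "ps \<noteq> []" and hd: "ps ! 0 = P"
      using play unfolding ungar_play_def by (auto simp: hd_conv_nth)
    have "K (ps ! n) \<longleftrightarrow> odd n" if "n < length ps" for n
      using that
    proof (induction n)
      case 0
      then show ?case
        using assms hd by simp
    next
      case (Suc n)
      have move: "ungar_move (ps ! n) (ps ! Suc n)"
        using play Suc.prems by (simp add: ungar_play_def successively_conv_nth)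
      have ideal: "order_ideal P (ps ! n)"
        using order_ideal_ungar_play[OF play] Suc.prems by simp
      show ?case
      proof (cases "odd n")
        case True
        then show ?thesis
          using Suc kernel[OF ideal] move by auto
      next
        case False
        let ?qs = "take (Suc n) ps"
        have last: "last ?qs = ps ! n"
          using Suc.prems by (simp add: take_Suc_conv_app_nth)
        have "successively ungar_move (?qs @ drop (Suc n) ps)"
          using play unfolding ungar_play_def by simp
        then have "successively ungar_move ?qs"
          by (simp only: successively_append_iff)
        then have "ungar_play P ?qs"
          using play nonempty by (simp add: ungar_play_def)
        then have "K (ps ! n) \<or> K (\<sigma> ?qs)"
          using \<sigma>[of ?qs] move last by auto
        moreover have "ps ! Suc n = \<sigma> ?qs"
          using ps(2) False Suc.prems unfolding follows_strategy_def by auto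
        ultimately show ?thesis
          using Suc False by auto
      qed
    qed
    from this[of "length ps - 1"] have "K (last ps) \<longleftrightarrow> odd (length ps - 1)"
      using nonempty by (simp add: last_conv_nth)
    moreover have "K (last ps)"
      using kernel[OF order_ideal_ungar_play[OF play]] nonempty stuck by simp
    ultimately show ?thesis
      using nonempty by (cases ps) auto
  qed
  with strategy show ?thesis
    unfolding atniss_win_def by blast
qed

lemma eeta_win_iff_kernel: "eeta_win P \<longleftrightarrow> K P"
proof
  show "eeta_win P \<Longrightarrow> K P"
    using atniss_win_outside_kernel unfolding eeta_win_def by blast
next
  assume "K P"
  show "eeta_win P"
    unfolding eeta_win_def atniss_win_def
  proof
    assume "\<exists>\<sigma>. atniss_strategy P \<sigma> \<and>
      (\<forall>ps. complete_ungar_play P ps \<and> follows_strategy \<sigma> ps \<longrightarrow> even (length ps))"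
    then obtain \<sigma> where \<sigma>: "atniss_strategy P \<sigma>"
      "\<And>ps. complete_ungar_play P ps \<Longrightarrow> follows_strategy \<sigma> ps \<Longrightarrow> even (length ps)"
      by blast
    have "ungar_play P [P]" "follows_strategy \<sigma> [P]"
      by (auto simp: ungar_play_def follows_strategy_def)
    then show False
      using losing_play_from_kernel[OF \<sigma>(1), of "[P]"] \<open>K P\<close> \<sigma>(2) by auto
  qed
qed

end

section \<open>The trees hanging below maximal elements\<close>

text \<open>
  For \<open>c\<close> in the skeleton of \<open>X\<close>, these are the skeleton elements covered by \<open>c\<close>. The formula also
  makes sense for other \<open>c\<close>, and it does not depend on the elements above \<open>c\<close>.
\<close>

definition branches :: "'a::order set \<Rightarrow> 'a \<Rightarrow> 'a set" where
  "branches X c = {z \<in> X. z < c \<and> (\<forall>y\<in>X. z < y \<longrightarrow> c \<le> y)}"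

text \<open>
  The value of the tree with root \<open>c\<close> for the player to move. For infinite \<open>X\<close>, where the
  recursion need not terminate, the value is fixed arbitrarily.
\<close>

function tree_win :: "'a::order set \<Rightarrow> 'a \<Rightarrow> bool" where
  "tree_win X c \<longleftrightarrow> (finite X \<longrightarrow> (\<forall>z\<in>branches X c. \<not> tree_win X z))"
  by auto
termination
proof (relation "measure (\<lambda>(X, c). card {y \<in> X. y < c})", goal_cases)
  case 1
  then show ?case by simp
next
  case (2 X c z)
  then have "{y \<in> X. y < z} \<subset> {y \<in> X. y < c}"
    unfolding branches_def by (auto dest: less_trans)
  with 2 show ?case
    by (simp add: psubset_card_mono)
qed

declare tree_win.simps [simp del]

lemma tree_win_iff: "finite X \<Longrightarrow> tree_win X c \<longleftrightarrow> (\<forall>z\<in>branches X c. \<not> tree_win X z)"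
  by (subst tree_win.simps) simp

definition no_tree_win :: "'a::order set \<Rightarrow> bool" where
  "no_tree_win X \<longleftrightarrow> (\<forall>m\<in>maximal_elements X. \<not> tree_win X m)"

section \<open>Deleting maximal elements of a graded poset\<close>

definition rank_function :: "('a::order \<Rightarrow> nat) \<Rightarrow> 'a set \<Rightarrow> bool" where
  "rank_function \<rho> X \<longleftrightarrow> (\<forall>x y. covers_in X x y \<longrightarrow> \<rho> x = \<rho> y + 1)"

lemma rank_function_order_ideal:
  assumes "rank_function \<rho> P" "order_ideal P X"
  shows "rank_function \<rho> X"
  unfolding rank_function_def
proof (intro allI impI)
  fix x y assume xy: "covers_in X x y"
  then have "covers_in P x y"
    using assms(2) less_imp_le unfolding covers_in_def order_ideal_def by blast
  then show "\<rho> x = \<rho> y + 1"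
    using assms(1) unfolding rank_function_def by blast
qed

lemma order_ideal_Diff_maximal:
  assumes "T \<subseteq> maximal_elements X"
  shows "order_ideal X (X - T)"
  using assms unfolding order_ideal_def maximal_elements_def by (auto simp: order_le_less)

lemma branch_rank:
  assumes "rank_function \<rho> X" "d \<in> X" "z \<in> branches X d"
  shows "\<rho> d = \<rho> z + 1"
proof -
  have "covers_in X d z"
    using assms(2,3) unfolding covers_in_def branches_def by auto
  then show ?thesis
    using assms(1) unfolding rank_function_def by blast
qed

text \<open>
  If nothing of \<open>X - T\<close> lies strictly between \<open>z\<close> and \<open>t \<in> T\<close>, then \<open>t\<close> covers \<open>z\<close>, because elements below \<open>t\<close> are
  not maximal and so cannot belong to \<open>T\<close>.
\<close>

lemma rank_below_deleted:
  assumes "rank_function \<rho> X" "T \<subseteq> maximal_elements X" "z \<in> X" "t \<in> T" "z < t"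
    and "\<And>w. w \<in> X - T \<Longrightarrow> z < w \<Longrightarrow> \<not> w < t"
  shows "\<rho> t = \<rho> z + 1"
proof -
  have "t \<in> X"
    using assms(2,4) unfolding maximal_elements_def by blast
  moreover have "w \<notin> T" if "w < t" for w
    using that assms(2) \<open>t \<in> X\<close> unfolding maximal_elements_def by blast
  ultimately have "covers_in X t z"
    using assms unfolding covers_in_def by blast
  then show ?thesis
    using assms(1) unfolding rank_function_def by blast
qed

lemma above_exposed_maximal:
  assumes "rank_function \<rho> X" "T \<subseteq> maximal_elements X"
    and "m \<in> maximal_elements (X - T)" "y \<in> X" "m < y"
  shows "y \<in> T" "\<rho> y = \<rho> m + 1"
proof -
  show "y \<in> T"
    using assms(3-5) unfolding maximal_elements_def by blast
  then show "\<rho> y = \<rho> m + 1"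
    using assms by (intro rank_below_deleted[of \<rho> X T]) (auto simp: maximal_elements_def)
qed

text \<open>
  A new branch \<open>z\<close> below \<open>d\<close> was kept from being one by some \<open>t \<in> T\<close>. Both \<open>d\<close> and \<open>t\<close>
  cover \<open>z\<close>, so they have equal rank.
\<close>

lemma branches_Diff:
  assumes \<rho>: "rank_function \<rho> X" and T: "T \<subseteq> maximal_elements X"
    and d: "d \<in> X" "\<forall>t\<in>T. \<rho> t \<noteq> \<rho> d"
  shows "branches (X - T) d = branches X d"
proof
  show "branches X d \<subseteq> branches (X - T) d"
    using T d(1) unfolding branches_def maximal_elements_def by auto
next
  show "branches (X - T) d \<subseteq> branches X d"
  proof
    fix z assume z: "z \<in> branches (X - T) d"
    have "d \<in> X - T"
      using d by blast
    then have rank_d: "\<rho> d = \<rho> z + 1"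
      using branch_rank[OF rank_function_order_ideal[OF \<rho> order_ideal_Diff_maximal[OF T]] _ z]
      by blast
    have "d \<le> y" if y: "y \<in> X" "z < y" for y
    proof (cases "y \<in> T")
      case False
      then show ?thesis
        using y z unfolding branches_def by blast
    next
      case True
      show ?thesis
      proof (rule ccontr)
        assume "\<not> d \<le> y"
        then have "\<not> w < y" if "w \<in> X - T" "z < w" for w
          using z that unfolding branches_def by (auto dest: order.strict_trans1 less_imp_le)
        then have "\<rho> y = \<rho> z + 1"
          using rank_below_deleted[OF \<rho> T _ True y(2)] z unfolding branches_def by blast
        then show False
          using d(2) True rank_d by simp
      qed
    qed
    then show "z \<in> branches X d"
      using z unfolding branches_def by blast
  qed
qed

text \<open>
  Ranks decrease along branches, so no root of a subtree below \<open>c\<close> has the rank of a deleted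
  element, and the whole tree below \<open>c\<close> is unchanged.
\<close>

lemma tree_win_Diff:
  assumes "finite X" "rank_function \<rho> X" "T \<subseteq> maximal_elements X"
    and "c \<in> X" "\<forall>t\<in>T. \<rho> c < \<rho> t"
  shows "tree_win (X - T) c \<longleftrightarrow> tree_win X c"
  using assms(4,5)
proof (induction "\<rho> c" arbitrary: c rule: less_induct)
  case less
  have "branches (X - T) c = branches X c"
    using branches_Diff[OF assms(2,3) less.prems(1)] less.prems(2) by fastforce
  moreover have "tree_win (X - T) z \<longleftrightarrow> tree_win X z" if z: "z \<in> branches X c" for z
  proof -
    have "\<rho> z < \<rho> c"
      using branch_rank[OF assms(2) less.prems(1) z] by simp
    then show ?thesis
      using less.hyps[of z] less.prems z unfolding branches_def by fastforce
  qed
  ultimately show ?case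
    using assms(1) by (simp add: tree_win_iff[of X c] tree_win_iff[of "X - T" c])
qed

section \<open>Positions without winning trees are exactly the lost ones\<close>

lemma no_tree_win_imp_not_no_tree_win_Diff:
  assumes "finite X" "rank_function \<rho> X" "no_tree_win X"
    and T: "T \<noteq> {}" "T \<subseteq> maximal_elements X"
  shows "\<not> no_tree_win (X - T)"
proof -
  obtain t where t: "t \<in> T" "\<forall>s\<in>T. \<rho> t \<le> \<rho> s"
    using ex_has_least_nat[of "\<lambda>s. s \<in> T" _ \<rho>] T(1) by blast
  have "t \<in> X"
    using T t unfolding maximal_elements_def by blast
  have "\<not> tree_win X t"
    using assms(3) T t unfolding no_tree_win_def by blast
  then obtain c where c: "c \<in> branches X t" "tree_win X c"
    using tree_win_iff[OF assms(1)] by blast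
  have "c \<in> X" "c < t"
    using c unfolding branches_def by auto
  have "\<rho> t = \<rho> c + 1"
    by (rule branch_rank[OF assms(2) \<open>t \<in> X\<close> c(1)])
  then have "\<forall>s\<in>T. \<rho> c < \<rho> s"
    using t(2) by fastforce
  then have "tree_win (X - T) c"
    using tree_win_Diff[OF assms(1,2) T(2) \<open>c \<in> X\<close>] c(2) by blast
  moreover have "c \<in> maximal_elements (X - T)"
  proof -
    have "c \<notin> T"
      using \<open>t \<in> X\<close> \<open>c < t\<close> T(2) unfolding maximal_elements_def by blast
    moreover have "\<not> c < y" if "y \<in> X - T" for y
    proof
      assume "c < y"
      then have "t \<le> y"
        using that c unfolding branches_def by blast
      moreover have "t \<noteq> y"
        using that t by blast
      ultimately have "t < y"
        by simp
      then show False
        using that t T unfolding maximal_elements_def by blast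
    qed
    ultimately show ?thesis
      using \<open>c \<in> X\<close> unfolding maximal_elements_def by blast
  qed
  ultimately show ?thesis
    unfolding no_tree_win_def by blast
qed

text \<open>
  In the induction over \<open>k\<close> this lemma is applied to what is left of the poset after the choices for smaller ranks.
  Those choices are not disturbed: deleting elements of rank \<open>k\<close> preserves the values of all trees
  of smaller rank, and the newly exposed elements have rank \<open>k - 1\<close>.
\<close>

lemma clear_rank:
  assumes fin: "finite X" and \<rho>: "rank_function \<rho> X"
    and low: "\<And>m. m \<in> maximal_elements X \<Longrightarrow> \<rho> m < k \<Longrightarrow> \<not> tree_win X m"
  obtains S where "S \<subseteq> {m \<in> maximal_elements X. \<rho> m = k}"
    and "\<And>m. m \<in> maximal_elements (X - S) \<Longrightarrow> \<rho> m \<le> k \<Longrightarrow> \<not> tree_win (X - S) m"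
proof -
  let ?R = "{m \<in> maximal_elements X. \<rho> m = k}"
  \<comment> \<open>The value is taken in \<open>X\<close>: for roots of rank below \<open>k\<close> it is the same as in \<open>X - S\<close>.\<close>
  define safe where "safe S \<longleftrightarrow> S \<subseteq> ?R \<and>
    (\<forall>m\<in>maximal_elements (X - S). \<rho> m < k \<longrightarrow> \<not> tree_win X m)" for S
  have "finite ?R"
    using fin unfolding maximal_elements_def by simp
  then have "finite {S. safe S}"
    by (rule rev_finite_subset[OF finite_Pow_iff[THEN iffD2]]) (auto simp: safe_def)
  moreover have "{} \<in> {S. safe S}"
    using low by (simp add: safe_def)
  ultimately obtain S where S: "safe S" and max: "\<And>S'. safe S' \<Longrightarrow> S \<subseteq> S' \<Longrightarrow> S = S'"
    using finite_has_maximal[of "{S. safe S}"] by blast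
  have SR: "S \<subseteq> ?R"
    using S unfolding safe_def by blast
  then have SM: "S \<subseteq> maximal_elements X"
    by blast
  have keep: "tree_win (X - S) c \<longleftrightarrow> tree_win X c" if "c \<in> X" "\<rho> c < k" for c
    using tree_win_Diff[OF fin \<rho> SM that(1)] that(2) SR by auto
  have "\<not> tree_win (X - S) m" if m: "m \<in> maximal_elements (X - S)" "\<rho> m \<le> k" for m
  proof (cases "\<rho> m < k")
    case True
    moreover have "m \<in> X"
      using m unfolding maximal_elements_def by blast
    ultimately show ?thesis
      using keep S m unfolding safe_def by blast
  next
    case False
    with m have rank_m: "\<rho> m = k"
      by simp
    have "\<not> m < y" if "y \<in> X" for y
    proof
      assume "m < y"
      then have "y \<in> S" "\<rho> y = \<rho> m + 1"
        using above_exposed_maximal[OF \<rho> SM m(1) that] by auto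
      then show False
        using SR rank_m by auto
    qed
    then have "insert m S \<subseteq> ?R" "m \<in> X" "m \<notin> S"
      using m rank_m SR unfolding maximal_elements_def by auto
    then have "\<not> safe (insert m S)"
      using max by blast
    then obtain c where c: "c \<in> maximal_elements (X - insert m S)" "\<rho> c < k" "tree_win X c"
      using \<open>insert m S \<subseteq> ?R\<close> unfolding safe_def by blast
    have "c \<notin> maximal_elements (X - S)"
      using S c unfolding safe_def by blast
    then have "c \<in> branches (X - S) m"
      using c(1) \<open>m \<in> X\<close> \<open>m \<notin> S\<close> unfolding branches_def maximal_elements_def by blast
    moreover have "tree_win (X - S) c"
      using keep c unfolding maximal_elements_def by blast
    ultimately show ?thesis
      using tree_win_iff[of "X - S" m] fin by blast
  qed
  with SR show thesis
    using that by blast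
qed

lemma clear_ranks_below:
  assumes fin: "finite X" and \<rho>: "rank_function \<rho> X"
  shows "\<exists>T \<subseteq> maximal_elements X. (\<forall>t\<in>T. \<rho> t < k) \<and>
    (\<forall>m\<in>maximal_elements (X - T). \<rho> m < k \<longrightarrow> \<not> tree_win (X - T) m)"
proof (induction k)
  case 0
  show ?case
    by (intro exI[of _ "{}"]) simp
next
  case (Suc k)
  then obtain T where T: "T \<subseteq> maximal_elements X" "\<forall>t\<in>T. \<rho> t < k"
    and low: "\<And>m. m \<in> maximal_elements (X - T) \<Longrightarrow> \<rho> m < k \<Longrightarrow> \<not> tree_win (X - T) m"
    by blast
  have "finite (X - T)" "rank_function \<rho> (X - T)"
    using fin rank_function_order_ideal[OF \<rho> order_ideal_Diff_maximal[OF T(1)]] by auto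
  then obtain S where S: "S \<subseteq> {m \<in> maximal_elements (X - T). \<rho> m = k}"
    and clear: "\<And>m. m \<in> maximal_elements (X - T - S) \<Longrightarrow> \<rho> m \<le> k \<Longrightarrow> \<not> tree_win (X - T - S) m"
    using clear_rank[OF _ _ low] by blast
  \<comment> \<open>Deleting \<open>T\<close> exposes only elements of rank below \<open>k - 1\<close>, so \<open>S\<close> was maximal beforehand.\<close>
  have "s \<in> maximal_elements X" if "s \<in> S" for s
  proof -
    have s: "s \<in> maximal_elements (X - T)" "\<rho> s = k"
      using S that by auto
    have "\<not> s < y" if "y \<in> X" for y
      using above_exposed_maximal[OF \<rho> T(1) s(1) that] T(2) s(2) by fastforce
    then show ?thesis
      using s(1) unfolding maximal_elements_def by blast
  qed
  then have "T \<union> S \<subseteq> maximal_elements X" "\<forall>t\<in>T \<union> S. \<rho> t < Suc k"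
    using T S by (auto simp: less_Suc_eq)
  moreover have "X - (T \<union> S) = X - T - S"
    by blast
  ultimately show ?case
    using clear by (metis less_Suc_eq_le)
qed

lemma no_tree_win_iff_moves:
  assumes "finite X" "rank_function \<rho> X"
  shows "no_tree_win X \<longleftrightarrow> (\<forall>Y. ungar_move X Y \<longrightarrow> \<not> no_tree_win Y)"
proof (intro iffI allI impI)
  fix Y assume "no_tree_win X" "ungar_move X Y"
  then show "\<not> no_tree_win Y"
    using no_tree_win_imp_not_no_tree_win_Diff[OF assms] by (elim ungar_moveE) blast
next
  assume no_move: "\<forall>Y. ungar_move X Y \<longrightarrow> \<not> no_tree_win Y"
  define k where "k = Suc (\<Sum>x\<in>X. \<rho> x)"
  have k: "\<rho> x < k" if "x \<in> X" for x
    using member_le_sum[of x X \<rho>] that assms(1) by (simp add: k_def)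
  obtain T where T: "T \<subseteq> maximal_elements X"
    "\<forall>m\<in>maximal_elements (X - T). \<rho> m < k \<longrightarrow> \<not> tree_win (X - T) m"
    using clear_ranks_below[OF assms, of k] by blast
  then have none: "no_tree_win (X - T)"
    using k unfolding no_tree_win_def maximal_elements_def by blast
  then have "T = {}"
    using no_move T(1) unfolding ungar_move_def by blast
  with none show "no_tree_win X"
    by simp
qed

lemma eeta_win_iff_no_tree_win:
  assumes "finite P" "graded_poset P"
  shows "eeta_win P \<longleftrightarrow> no_tree_win P"
proof -
  obtain \<rho> where \<rho>: "rank_function \<rho> P"
    using assms(2) unfolding graded_poset_def rank_function_def by blast
  have "no_tree_win X \<longleftrightarrow> (\<forall>Y. ungar_move X Y \<longrightarrow> \<not> no_tree_win Y)" if "order_ideal P X" for X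
  proof (rule no_tree_win_iff_moves)
    show "finite X"
      using that assms(1) finite_subset unfolding order_ideal_def by blast
    show "rank_function \<rho> X"
      by (rule rank_function_order_ideal[OF \<rho> that])
  qed
  then show ?thesis
    using eeta_win_iff_kernel[of P no_tree_win] assms(1) by blast
qed

section \<open>Comparison with the skeleton\<close>

lemma skeleton_subset: "skeleton P \<subseteq> P"
  unfolding skeleton_def by blast

lemma skeleton_upward_closed:
  assumes "x \<in> skeleton P" "y \<in> P" "x < y"
  shows "y \<in> skeleton P"
  using assms unfolding skeleton_def by (blast intro: less_trans)

lemma graded_poset_skeleton:
  assumes "graded_poset P"
  shows "graded_poset (skeleton P)"
proof -
  have "covers_in P x y" if "covers_in (skeleton P) x y" for x y
    using that skeleton_upward_closed[of y P] skeleton_subset[of P]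
    unfolding covers_in_def by blast
  then show ?thesis
    using assms unfolding graded_poset_def by blast
qed

lemma maximal_elements_skeleton: "maximal_elements (skeleton P) = maximal_elements P"
proof -
  have "maximal_elements P \<subseteq> skeleton P"
    unfolding maximal_elements_def skeleton_def by blast
  then show ?thesis
    using skeleton_upward_closed[of _ P] skeleton_subset[of P]
    unfolding maximal_elements_def by blast
qed

text \<open>
  The strict upper bounds of a branch below \<open>c\<close> are \<open>c\<close> and the strict upper bounds of \<open>c\<close>, hence a
  chain if \<open>c\<close> is in the skeleton.
\<close>

lemma branches_subset_skeleton:
  assumes "c \<in> skeleton P"
  shows "branches P c \<subseteq> skeleton P"
proof
  fix z assume z: "z \<in> branches P c"
  have "\<not> incomparable a b" if "a \<in> P" "b \<in> P" "z < a" "z < b" for a b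
  proof -
    have "c \<le> a" "c \<le> b"
      using z that unfolding branches_def by auto
    then show ?thesis
      using assms that unfolding skeleton_def incomparable_def by (auto simp: order_le_less)
  qed
  then show "z \<in> skeleton P"
    using z unfolding skeleton_def branches_def by blast
qed

lemma branches_skeleton:
  assumes "c \<in> skeleton P"
  shows "branches (skeleton P) c = branches P c"
  using branches_subset_skeleton[OF assms] skeleton_upward_closed[of _ P] skeleton_subset[of P]
  unfolding branches_def by blast

lemma tree_win_skeleton:
  assumes "finite P" "c \<in> skeleton P"
  shows "tree_win (skeleton P) c \<longleftrightarrow> tree_win P c"
  using assms
proof (induction P c rule: tree_win.induct)
  case (1 P c)
  have "finite (skeleton P)"
    using "1.prems"(1) skeleton_subset finite_subset by blast
  moreover have "tree_win (skeleton P) z \<longleftrightarrow> tree_win P z" if "z \<in> branches P c" for z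
    using 1 that branches_subset_skeleton by blast
  ultimately show ?case
    using "1.prems" by (simp add: tree_win_iff[of _ c] branches_skeleton)
qed

lemma no_tree_win_skeleton:
  assumes "finite P"
  shows "no_tree_win (skeleton P) \<longleftrightarrow> no_tree_win P"
proof -
  have "m \<in> skeleton P" if "m \<in> maximal_elements P" for m
    using that maximal_elements_skeleton[of P] unfolding maximal_elements_def by blast
  then show ?thesis
    using tree_win_skeleton[OF assms]
    unfolding no_tree_win_def maximal_elements_skeleton by blast
qed

theorem theorem1p6:
  fixes P :: "'a::order set"
  assumes "finite P"
    and "graded_poset P"
  shows "eeta_win P \<longleftrightarrow> eeta_win (skeleton P)"
proof -
  have "finite (skeleton P)"
    using assms(1) skeleton_subset finite_subset by blast
  then show ?thesis
    using eeta_win_iff_no_tree_win[OF assms] graded_poset_skeleton[OF assms(2)]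
      eeta_win_iff_no_tree_win no_tree_win_skeleton[OF assms(1)] by blast
qed

end
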